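(* For all $\lambda \in \mathbb{C}$ and all integers $n\ge 0$, $$\mathcal{E}_{n}(x;\lambda) = - \frac{2}{n+1} \mathcal{B}_{n+1}(x;-\lambda).$$ In particular, for $\lambda = 1$, $$\mathcal{B}_{n}(x;-1) = - \frac{n}{2} E_{n-1}(x), \quad n \geq 1,$$ and for $\lambda = -1$, $$\mathcal{E}_{n}(x;-1) = - \frac{2}{n+1} B_{n+1}(x), \quad n \geq 1.$$
   Context: The Apostol-Bernoulli polynomials $\mathcal{B}_n(x;\lambda)$ ($n\ge 0$, $\lambda\in\mathbb{C}$) are defined by the power series expansion at $z=0$ $$\frac{z e^{xz}}{\lambda e^z-1} = \sum_{n=0}^\infty \mathcal{B}_n(x;\lambda)\, \frac{z^n}{n!}$$ (for $\lambda=1$ the singularity at $z=0$ is removable), and $B_n(x)=\mathcal{B}_n(x;1)$ are the classical Bernoulli polynomials. The Apostol-Euler polynomials $\mathcal{E}_n(x;\lambda)$ ($n\ge 0$, $\lambda\in\mathbb{C}$) are defined by letting $\frac{1}{n!}\mathcal{E}_n(x;\lambda)$ be the coefficient of $z^n$ in the Laurent expansion around $z=0$ of $\frac{2e^{zx}}{\lambda e^z+1}$; for $\lambda\neq -1$ this is a power series expansion, while for $\lambda=-1$ there is a simple pole at $z=0$. $E_n(x)=\mathcal{E}_n(x;1)$ are the classical Euler polynomials. *)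

theory Defs
  imports "HOL-Complex_Analysis.Complex_Analysis"
begin

(* With division by zero yielding 0, the generating function takes the wrong value at z = 0
   for lam = 1; remove_sings fills in the limit there and changes nothing near 0 for lam \<noteq> 1. *)
definition apostol_bernoulli :: "nat \<Rightarrow> complex \<Rightarrow> complex \<Rightarrow> complex" where
  "apostol_bernoulli n x lam =
     fact n * fps_nth (fps_expansion
       (remove_sings (\<lambda>z. z * exp (x * z) / (lam * exp z - 1))) 0) n"

definition bernoulli_poly :: "nat \<Rightarrow> complex \<Rightarrow> complex" where
  "bernoulli_poly n x = apostol_bernoulli n x 1"

definition apostol_euler :: "nat \<Rightarrow> complex \<Rightarrow> complex \<Rightarrow> complex" where
  "apostol_euler n x lam =
     fact n * fls_nth (laurent_expansion (\<lambda>z. 2 * exp (z * x) / (lam * exp z + 1)) 0) (int n)"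

definition euler_poly :: "nat \<Rightarrow> complex \<Rightarrow> complex" where
  "euler_poly n x = apostol_euler n x 1"

lemma apostol_bernoulli_sums:
  "eventually (\<lambda>z. (\<lambda>n. apostol_bernoulli n x lam * (z ^ n / fact n)) sums
     (z * exp (x * z) / (lam * exp z - 1))) (at 0)"
proof -
  define f where "f = (\<lambda>z. z * exp (x * z) / (lam * exp z - 1))"
  have lim: "\<exists>c. f \<midarrow>0\<rightarrow> c"
  proof (cases "lam = 1")
    case True
    have "((\<lambda>z::complex. (exp z - 1) / z) \<longlongrightarrow> 1) (at 0)"
      using DERIV_exp[of "0::complex"] by (simp add: DERIV_def)
    hence "((\<lambda>z. exp (x * z) / ((exp z - 1) / z)) \<longlongrightarrow> exp (x * 0) / 1) (at 0)"
      by (intro tendsto_intros) auto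
    thus ?thesis using True by (auto simp: f_def field_simps)
  next
    case False
    have "f \<midarrow>0\<rightarrow> 0 * exp (x * 0) / (lam * exp 0 - 1)"
      unfolding f_def by (intro tendsto_intros) (use False in auto)
    thus ?thesis by blast
  qed
  have "f meromorphic_on {0}" unfolding f_def
    by (intro meromorphic_intros analytic_on_imp_meromorphic_on analytic_intros)
  hence iso: "isolated_singularity_at f 0"
    by (simp add: meromorphic_at_iff)
  from lim obtain c where "f \<midarrow>0\<rightarrow> c" by blast
  with iso have "remove_sings f analytic_on {0}" by (rule remove_sings_analytic_at)
  hence F: "remove_sings f has_fps_expansion fps_expansion (remove_sings f) 0" (is "_ has_fps_expansion ?F")
    by (rule analytic_at_imp_has_fps_expansion_0)
  hence "fps_conv_radius ?F > 0" and ev: "eventually (\<lambda>z. eval_fps ?F z = remove_sings f z) (at 0)"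
    by (auto simp: has_fps_expansion_def eventually_nhds_conv_at)
  hence "eventually (\<lambda>z. z \<in> eball 0 (fps_conv_radius ?F)) (at 0)"
    by (intro eventually_at_in_open') (auto simp: zero_ereal_def)
  with ev have "eventually (\<lambda>z. (\<lambda>n. fps_nth ?F n * z ^ n) sums remove_sings f z) (at 0)"
  proof eventually_elim
    case (elim z)
    thus ?case using sums_eval_fps[of z ?F] by (simp add: in_eball_iff)
  qed
  thus ?thesis using eventually_remove_sings_eq_at[OF iso]
    by eventually_elim (simp add: apostol_bernoulli_def f_def)
qed

lemma apostol_euler_has_laurent_expansion:
  "(\<lambda>z. 2 * exp (z * x) / (lam * exp z + 1)) has_laurent_expansion
     laurent_expansion (\<lambda>z. 2 * exp (z * x) / (lam * exp z + 1)) 0"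
proof -
  define f where "f = (\<lambda>z. 2 * exp (z * x) / (lam * exp z + 1))"
  have "f meromorphic_on {0}" unfolding f_def
    by (intro meromorphic_intros analytic_on_imp_meromorphic_on analytic_intros)
  then obtain F where "f has_laurent_expansion F"
    unfolding meromorphic_on_def by auto
  thus ?thesis unfolding f_def[symmetric]
    using not_essential_has_laurent_expansion_0 has_laurent_expansion_isolated_0
      has_laurent_expansion_not_essential_0 by blast
qed

end

theory Submission
  imports Defs
begin

text \<open>
  The two generating functions differ only by a monomial factor: for every \<open>lam\<close>,
  \<open>z exp (x z) / (- lam exp z - 1) = - (z / 2) (2 exp (z x) / (lam exp z + 1))\<close>.
  Multiplying a Laurent series by \<open>z\<close> shifts its coefficients by one place, so uniqueness of the
  Laurent expansion at \<open>0\<close> equates the coefficient of \<open>z ^ (n + 1)\<close> on the left with \<open>-1/2\<close> times the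
  coefficient of \<open>z ^ n\<close> on the right; the factorials contribute the factor \<open>n + 1\<close>.  Working with
  Laurent series throughout treats the pole of the Euler generating function at \<open>lam = -1\<close>
  together with all other parameters.
\<close>

text \<open>
  A pointwise power series representation on a punctured neighbourhood is enough for a Laurent
  expansion, since convergence at a single nonzero point already forces a positive radius of
  convergence.
\<close>
lemma has_laurent_expansion_if_eventually_sums:
  fixes f :: "complex \<Rightarrow> complex"
  assumes "eventually (\<lambda>z. (\<lambda>n. c n * z ^ n) sums f z) (at 0)"
  shows "f has_laurent_expansion fps_to_fls (Abs_fps c)"
proof -
  have "eventually (\<lambda>z. (\<lambda>n. c n * z ^ n) sums f z \<and> z \<noteq> 0) (at 0)"
    using assms eventually_neq_at_within[of 0 0 UNIV] by eventually_elim auto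
  then obtain z where z: "(\<lambda>n. c n * z ^ n) sums f z" "z \<noteq> 0"
    using eventually_happens'[of "at (0::complex)"] by auto
  have "0 < ereal (norm z)"
    using z(2) by simp
  also have "\<dots> \<le> fps_conv_radius (Abs_fps c)"
    unfolding fps_conv_radius_def using z(1) by (intro conv_radius_geI) (auto dest: sums_summable)
  finally have radius: "fps_conv_radius (Abs_fps c) > 0" .
  have "eventually (\<lambda>z. z \<in> eball 0 (fps_conv_radius (Abs_fps c))) (at 0)"
    using radius by (intro eventually_at_in_open') (auto simp: zero_ereal_def)
  with assms have "eventually (\<lambda>z. eval_fls (fps_to_fls (Abs_fps c)) z = f z) (at 0)"
  proof eventually_elim
    case (elim z)
    thus ?case
      by (simp add: eval_fps_to_fls in_eball_iff eval_fps_def sums_iff)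
  qed
  with radius show ?thesis
    by (simp add: has_laurent_expansion_def)
qed

lemma apostol_bernoulli_has_laurent_expansion:
  "(\<lambda>z. z * exp (x * z) / (lam * exp z - 1)) has_laurent_expansion
     fps_to_fls (Abs_fps (\<lambda>n. apostol_bernoulli n x lam / fact n))"
  using apostol_bernoulli_sums[of x lam]
  by (intro has_laurent_expansion_if_eventually_sums) simp

text \<open>
  The index shift from comparing both expansions.  Only coefficients of nonnegative index on the
  Euler side are read off, so the constant Bernoulli coefficient, which corresponds to the
  residue at \<open>lam = -1\<close>, does not appear.
\<close>
lemma apostol_euler_eq_apostol_bernoulli:
  "apostol_euler n x lam = - (2 / of_nat (n + 1)) * apostol_bernoulli (n + 1) x (- lam)"
proof -
  define F where "F = laurent_expansion (\<lambda>z. 2 * exp (z * x) / (lam * exp z + 1)) 0"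
  define G where "G = fps_to_fls (Abs_fps (\<lambda>n. apostol_bernoulli n x (- lam) / fact n))"
  have "(\<lambda>z. - 1 / 2 * (z * (2 * exp (z * x) / (lam * exp z + 1))))
          has_laurent_expansion fls_const (- 1 / 2) * (fls_X * F)"
    unfolding F_def
    by (intro laurent_expansion_intros apostol_euler_has_laurent_expansion)
  also have "(\<lambda>z. - 1 / 2 * (z * (2 * exp (z * x) / (lam * exp z + 1)))) =
             (\<lambda>z. z * exp (x * z) / (- lam * exp z - 1))"
  proof
    fix z
    have "- lam * exp z - 1 = - (lam * exp z + 1)"
      by simp
    thus "- 1 / 2 * (z * (2 * exp (z * x) / (lam * exp z + 1))) =
          z * exp (x * z) / (- lam * exp z - 1)"
      by (simp only: divide_minus_right) (simp add: mult.commute)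
  qed
  finally have "G = fls_const (- 1 / 2) * (fls_X * F)"
    using apostol_bernoulli_has_laurent_expansion[of x "- lam"]
    unfolding G_def by (intro has_laurent_expansion_unique)
  hence "fls_nth G (int (n + 1)) = - 1 / 2 * fls_nth F (int n)"
    by (simp add: fls_X_times_conv_shift)
  hence "fls_nth F (int n) = - 2 * (apostol_bernoulli (n + 1) x (- lam) / fact (n + 1))"
    by (simp add: G_def nat_add_distrib)
  moreover have "apostol_euler n x lam = fact n * fls_nth F (int n)"
    by (simp add: apostol_euler_def F_def)
  moreover have "1 + of_nat n \<noteq> (0 :: complex)"
    using of_nat_neq_0[of n, where ?'a = complex] by simp
  ultimately show ?thesis
    by (simp add: divide_simps mult_ac)
qed

theorem lemma2:
  shows "(\<forall>(lam::complex) (n::nat) (x::complex).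
            apostol_euler n x lam = - (2 / of_nat (n + 1)) * apostol_bernoulli (n + 1) x (- lam))
       \<and> (\<forall>(n::nat) (x::complex). n \<ge> 1 \<longrightarrow>
            apostol_bernoulli n x (- 1) = - (of_nat n / 2) * euler_poly (n - 1) x)
       \<and> (\<forall>(n::nat) (x::complex). n \<ge> 1 \<longrightarrow>
            apostol_euler n x (- 1) = - (2 / of_nat (n + 1)) * bernoulli_poly (n + 1) x)"
proof (intro conjI allI impI)
  fix lam x :: complex and n :: nat
  show "apostol_euler n x lam = - (2 / of_nat (n + 1)) * apostol_bernoulli (n + 1) x (- lam)"
    by (rule apostol_euler_eq_apostol_bernoulli)
next
  fix n :: nat and x :: complex
  assume "n \<ge> 1"
  thus "apostol_bernoulli n x (- 1) = - (of_nat n / 2) * euler_poly (n - 1) x"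
    using apostol_euler_eq_apostol_bernoulli[of "n - 1" x 1] by (simp add: euler_poly_def)
next
  fix n :: nat and x :: complex
  show "apostol_euler n x (- 1) = - (2 / of_nat (n + 1)) * bernoulli_poly (n + 1) x"
    using apostol_euler_eq_apostol_bernoulli[of n x "- 1"] by (simp add: bernoulli_poly_def)
qed

end
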